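(* Fix $d\ge 2$ and let $g:(0,\infty)\to(0,\infty)$ be a function of polynomial growth. The following are equivalent: (i) There exists a Danzer set $Y\subseteq\mathbb{R}^d$ of growth $g(T)$. (ii) For every $\varepsilon>0$ there exists a set $N_\varepsilon\subseteq[0,1]^d$ such that $N_\varepsilon$ intersects every rectangle of volume $\varepsilon$ contained in $[0,1]^d$, and such that $\#N_\varepsilon=O(g(\varepsilon^{-1/d}))$ as $\varepsilon\to 0$.
   Context: A set $Y\subseteq\mathbb{R}^d$ is a Danzer set if it intersects every convex subset of $\mathbb{R}^d$ of volume $1$. $Y$ has growth $g(T)$ if $\#(Y\cap B(0,T))=O(g(T))$ as $T\to\infty$, where $B(0,T)$ is the Euclidean ball of radius $T$ about the origin; $f(x)=O(g(x))$ means $\limsup_{x\to\infty}f(x)/g(x)<\infty$. A rectangle (or box) in $\mathbb{R}^d$ is a $d$-dimensional rectangular parallelepiped, not necessarily with axis-parallel edges. A function $g$ has polynomial growth if for every constant $C>0$ one has $g(Cx)=O(g(x))$ as $x\to\infty$. *)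

theory Defs
  imports "HOL-Analysis.Analysis" "HOL-Library.Landau_Symbols"
begin

text \<open>Convex sets of finite volume need not be Borel, but they are Lebesgue measurable; hence
  the measure \<^const>\<open>lebesgue\<close> rather than \<^const>\<open>lborel\<close>.\<close>

definition danzer_set :: "'a::euclidean_space set \<Rightarrow> bool" where
  "danzer_set Y \<longleftrightarrow> (\<forall>K. convex K \<and> measure lebesgue K = 1 \<longrightarrow> Y \<inter> K \<noteq> {})"

text \<open>\<open>#A(x) = O(g(x))\<close> along a filter, for counts in \<open>\<nat> \<union> {\<infinity>}\<close>. Finiteness is required
  explicitly, because \<^const>\<open>card\<close> is \<open>0\<close> on infinite sets.\<close>

definition card_bigo :: "real filter \<Rightarrow> (real \<Rightarrow> 'a set) \<Rightarrow> (real \<Rightarrow> real) \<Rightarrow> bool" where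
  "card_bigo F A g \<longleftrightarrow>
     eventually (\<lambda>x. finite (A x)) F \<and> (\<lambda>x. real (card (A x))) \<in> O[F](g)"

definition has_growth :: "'a::euclidean_space set \<Rightarrow> (real \<Rightarrow> real) \<Rightarrow> bool" where
  "has_growth Y g \<longleftrightarrow> card_bigo at_top (\<lambda>T. Y \<inter> ball 0 T) g"

definition polynomial_growth :: "(real \<Rightarrow> real) \<Rightarrow> bool" where
  "polynomial_growth g \<longleftrightarrow> (\<forall>C>0. (\<lambda>x. g (C * x)) \<in> O[at_top](g))"

text \<open>Closed, full-dimensional boxes in arbitrary orientation. No separate translation is
  needed: \<open>v + f ` cbox a b = f ` cbox (a + w) (b + w)\<close> where \<open>f w = v\<close>.\<close>

definition rectangle :: "'a::euclidean_space set \<Rightarrow> bool" where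
  "rectangle R \<longleftrightarrow>
     (\<exists>(f :: 'a \<Rightarrow> 'a) a b. orthogonal_transformation f \<and> (\<forall>i\<in>Basis. a \<bullet> i < b \<bullet> i) \<and> R = f ` cbox a b)"

end

theory Submission
  imports Defs "HOL-Real_Asymp.Real_Asymp"
begin

text \<open>From a Danzer set to nets one rescales. Conversely, a convex set of volume \<open>1\<close> contains a rectangle of
  volume bounded below; contracted towards its farthest point from the origin, at distance \<open>\<rho>\<close>, this
  rectangle lies in the annulus \<open>{x. \<rho>/2 \<le> \<bar>x\<bar> \<le> \<rho>}\<close>. Hence the union over \<open>k\<close> of the minimal nets for
  \<open>\<epsilon>\<^sub>k = \<kappa> / (8 * 3^k)^d\<close>, scaled up to \<open>[-3^k, 3^k]^d\<close> and restricted to \<open>\<bar>x\<bar> \<ge> 3^k/6\<close> when \<open>k > 0\<close>, is a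
  Danzer set. The cardinality of a minimal net at least doubles from \<open>\<epsilon>\<^sub>k\<close> to \<open>\<epsilon>\<^sub>k\<^sub>+\<^sub>1\<close>, so that the points
  in a ball are counted by a geometric sum, dominated by its last term even when \<open>g\<close> is not monotone.\<close>

section \<open>Rectangles under homotheties\<close>

text \<open>An orthogonal map is onto and commutes with scaling, so the translation can be moved
  inside it, where the map only changes the corners of the box.\<close>

lemma rectangle_affine:
  fixes R :: "'a::euclidean_space set"
  assumes "rectangle R" "m > 0"
  shows "rectangle ((\<lambda>x. m *\<^sub>R x + c) ` R)"
proof -
  obtain f :: "'a \<Rightarrow> 'a" and a b where f: "orthogonal_transformation f"
    and ab: "\<forall>i\<in>Basis. a \<bullet> i < b \<bullet> i" and R: "R = f ` cbox a b"
    using assms(1) by (auto simp: rectangle_def)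
  obtain w where w: "f w = c"
    using orthogonal_transformation_surj[OF f] by (metis surjD)
  have lin: "linear f"
    using f by (simp add: orthogonal_transformation_def)
  have eq: "m *\<^sub>R f x + c = f (m *\<^sub>R x + w)" for x
    by (simp add: linear_add[OF lin] linear_scale[OF lin] w)
  have ne: "cbox a b \<noteq> {}"
    using ab by (auto simp: box_ne_empty intro: less_imp_le)
  have "(\<lambda>x. m *\<^sub>R x + c) ` R = f ` ((\<lambda>x. m *\<^sub>R x + w) ` cbox a b)"
    by (simp add: R image_image eq)
  also have "(\<lambda>x. m *\<^sub>R x + w) ` cbox a b = cbox (m *\<^sub>R a + w) (m *\<^sub>R b + w)"
    using \<open>m > 0\<close> ne by (simp add: image_affinity_cbox)
  finally show ?thesis
    unfolding rectangle_def using f ab \<open>m > 0\<close>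
    by (intro exI[of _ f] exI[of _ "m *\<^sub>R a + w"] exI[of _ "m *\<^sub>R b + w"])
      (auto simp: inner_add_left)
qed

lemma
  fixes R :: "'a::euclidean_space set"
  assumes "rectangle R"
  shows convex_rectangle: "convex R" and compact_rectangle: "compact R"
    and rectangle_nonempty: "R \<noteq> {}"
proof -
  obtain f :: "'a \<Rightarrow> 'a" and a b where f: "orthogonal_transformation f"
    and ab: "\<forall>i\<in>Basis. a \<bullet> i < b \<bullet> i" and R: "R = f ` cbox a b"
    using assms by (auto simp: rectangle_def)
  have lin: "linear f"
    using f by (simp add: orthogonal_transformation_def)
  show "convex R"
    unfolding R by (rule convex_linear_image[OF lin convex_box(1)])
  show "compact R"
    unfolding R using lin by (intro compact_continuous_image linear_continuous_on compact_cbox)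
      (simp add: linear_conv_bounded_linear)
  show "R \<noteq> {}"
    unfolding R using ab by (auto simp: box_ne_empty intro: less_imp_le)
qed

lemma measure_homothety:
  fixes S :: "'a::euclidean_space set"
  assumes "m > 0"
  shows "measure lebesgue ((\<lambda>x. m *\<^sub>R x + c) ` S) = m ^ DIM('a) * measure lebesgue S"
  using measure_lebesgue_affine[of m c S] assms by (simp add: add.commute)

text \<open>Contracting towards a point of \<open>R\<close> stays inside \<open>R\<close> by
  convexity, and the factor \<open>t\<close> with \<open>t ^ DIM('a)\<close> equal to the volume
  ratio gives the volume. This is how nets for an exact volume also meet larger rectangles.\<close>

lemma subrectangle_of_measure:
  fixes R :: "'a::euclidean_space set"
  assumes R: "rectangle R" and \<epsilon>: "0 < \<epsilon>" "\<epsilon> \<le> measure lebesgue R"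
  obtains R' where "rectangle R'" "R' \<subseteq> R" "measure lebesgue R' = \<epsilon>"
proof -
  define t where "t = root DIM('a) (\<epsilon> / measure lebesgue R)"
  have pos: "measure lebesgue R > 0"
    using \<epsilon> by linarith
  have t: "0 < t" "t \<le> 1"
    using \<epsilon> pos by (simp_all add: t_def real_root_gt_zero)
  have tp: "t ^ DIM('a) = \<epsilon> / measure lebesgue R"
    unfolding t_def using \<epsilon> pos by (intro real_root_pow_pos2) auto
  obtain p where p: "p \<in> R"
    using rectangle_nonempty[OF R] by auto
  let ?R = "(\<lambda>x. t *\<^sub>R x + (1 - t) *\<^sub>R p) ` R"
  show thesis
  proof
    show "rectangle ?R"
      by (rule rectangle_affine[OF R t(1)])
    show "?R \<subseteq> R"
      using convexD[OF convex_rectangle[OF R] _ p, of _ t "1 - t"] t by auto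
    show "measure lebesgue ?R = \<epsilon>"
      using pos by (simp add: measure_homothety[OF t(1)] tp)
  qed
qed

section \<open>Large rectangles inside convex sets\<close>

text \<open>An indexed family rather than a set of vectors: the induction builds it index by index,
  and over \<open>Basis\<close> it gives the images of the basis vectors under an orthogonal
  map.\<close>

definition orthonormal_family :: "'b set \<Rightarrow> ('b \<Rightarrow> 'a::euclidean_space) \<Rightarrow> bool" where
  "orthonormal_family A u \<longleftrightarrow> (\<forall>i\<in>A. \<forall>j\<in>A. u i \<bullet> u j = (if i = j then 1 else 0))"

lemma orthonormal_inner_sum:
  assumes "orthonormal_family A u" "finite A" "i \<in> A"
  shows "(\<Sum>j\<in>A. t j *\<^sub>R u j) \<bullet> u i = t i"
proof -
  have "(\<Sum>j\<in>A. t j *\<^sub>R u j) \<bullet> u i = (\<Sum>j\<in>A. if j = i then t j else 0)"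
    unfolding inner_sum_left
    by (rule sum.cong) (use assms in \<open>auto simp: orthonormal_family_def\<close>)
  then show ?thesis
    using assms by simp
qed

text \<open>Choosing each new frame vector towards an (almost) farthest point of \<open>K\<close> from the span of the
  previous ones bounds the extent of \<open>K\<close> in that direction; coning the box built so far to that
  point, a slab of the cone contains a box of one more dimension.\<close>

lemma greedy_frame:
  fixes K :: "'a::euclidean_space set" and A :: "'b set"
  assumes K: "convex K" "bounded K" "0 \<in> K" "interior K \<noteq> {}"
  shows "finite A \<Longrightarrow> card A \<le> DIM('a) \<Longrightarrow>
    \<exists>u h b. orthonormal_family A u \<and>
      (\<forall>i\<in>A. h i > 0 \<and> (\<forall>x\<in>K. \<bar>x \<bullet> u i\<bar> \<le> 2 * h i)) \<and>
      (\<forall>t. (\<forall>i\<in>A. b i \<le> t i \<and> t i \<le> b i + h i / 16 ^ card A) \<longrightarrow> (\<Sum>i\<in>A. t i *\<^sub>R u i) \<in> K)"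
proof (induction A rule: finite_induct)
  case empty
  then show ?case
    using K by (auto simp: orthonormal_family_def)
next
  case (insert k A)
  then have "card A \<le> DIM('a)"
    by simp
  from insert.IH[OF this] obtain u :: "'b \<Rightarrow> 'a" and h b where u: "orthonormal_family A u"
    and h': "\<forall>i\<in>A. h i > 0 \<and> (\<forall>x\<in>K. \<bar>x \<bullet> u i\<bar> \<le> 2 * h i)"
    and box': "\<forall>t. (\<forall>i\<in>A. b i \<le> t i \<and> t i \<le> b i + h i / 16 ^ card A) \<longrightarrow>
      (\<Sum>i\<in>A. t i *\<^sub>R u i) \<in> K"
    by (elim exE conjE)
  have h: "\<And>i. i \<in> A \<Longrightarrow> h i > 0" "\<And>i x. i \<in> A \<Longrightarrow> x \<in> K \<Longrightarrow> \<bar>x \<bullet> u i\<bar> \<le> 2 * h i"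
    using h' by auto
  have box: "\<And>t. (\<And>i. i \<in> A \<Longrightarrow> b i \<le> t i \<and> t i \<le> b i + h i / 16 ^ card A) \<Longrightarrow>
      (\<Sum>i\<in>A. t i *\<^sub>R u i) \<in> K"
    using box' by blast
  define c :: real where "c = 1 / 16 ^ card A"
  have c: "0 < c" "c \<le> 1"
    by (simp_all add: c_def)
  \<comment> \<open>The component of \<open>x\<close> orthogonal to the frame built so far; its norm
    is the distance of \<open>x\<close> from the span.\<close>
  define r where "r x = x - (\<Sum>i\<in>A. (x \<bullet> u i) *\<^sub>R u i)" for x
  have r_orth: "r x \<bullet> u i = 0" if "i \<in> A" for x i
    using orthonormal_inner_sum[OF u \<open>finite A\<close> that] by (simp add: r_def inner_diff_left)
  have lin: "linear r"
    unfolding r_def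
    by (intro linearI)
      (simp_all add: inner_add_left scaleR_left_distrib sum.distrib scaleR_sum_right algebra_simps)
  have bdd: "bounded (r ` K)"
    using K(2) lin by (simp add: bounded_linear_image linear_conv_bounded_linear)
  then have bddn: "bdd_above ((\<lambda>x. norm (r x)) ` K)"
    by (auto simp: bounded_iff bdd_above_def)
  \<comment> \<open>Otherwise \<open>K\<close> lies in the span of fewer than \<open>DIM('a)\<close>
    vectors and has empty interior.\<close>
  have ex: "\<exists>x\<in>K. r x \<noteq> 0"
  proof (rule ccontr)
    assume "\<not> ?thesis"
    then have "x = (\<Sum>i\<in>A. (x \<bullet> u i) *\<^sub>R u i)" if "x \<in> K" for x
      using that by (auto simp: r_def)
    moreover have "(\<Sum>i\<in>A. (x \<bullet> u i) *\<^sub>R u i) \<in> span (u ` A)" for x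
      by (intro span_sum span_scale span_base) auto
    ultimately have "K \<subseteq> span (u ` A)"
      by (metis subsetI)
    then have "dim K \<le> card (u ` A)"
      using \<open>finite A\<close> by (intro dim_le_card) auto
    also have "\<dots> \<le> card A"
      using \<open>finite A\<close> by (rule card_image_le)
    also have "\<dots> < DIM('a)"
      using insert by simp
    finally show False
      using empty_interior_lowdim K(4) by blast
  qed
  define S where "S = (SUP x\<in>K. norm (r x))"
  have S_ub: "norm (r x) \<le> S" if "x \<in> K" for x
    unfolding S_def using bddn that by (rule cSUP_upper2) auto
  have "S > 0"
    using ex S_ub by (metis norm_le_zero_iff not_le order_trans)
  \<comment> \<open>\<open>K\<close> need not be closed, so the supremum may not be attained;
    settling for more than half of it is the source of the factor 2 in the extent bounds.\<close>
  then have "\<exists>p\<in>K. S / 2 < norm (r p)"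
    using less_cSUP_iff[OF _ bddn, of "S / 2"] K(3) unfolding S_def[symmetric] by auto
  then obtain p where p: "p \<in> K" "S / 2 < norm (r p)"
    by blast
  define \<eta> where "\<eta> = norm (r p)"
  have \<eta>: "\<eta> > 0" "S \<le> 2 * \<eta>"
    using p \<open>S > 0\<close> by (auto simp: \<eta>_def)
  define v where "v = r p /\<^sub>R \<eta>"
  have v1: "v \<bullet> v = 1"
    using \<eta> by (simp add: v_def \<eta>_def dot_square_norm power2_eq_square)
  have vu: "u i \<bullet> v = 0" "v \<bullet> u i = 0" if "i \<in> A" for i
    using r_orth[OF that] by (simp_all add: v_def inner_commute)
  have nv: "norm v = 1"
    using v1 by (simp add: norm_eq_1)
  have v_bd: "\<bar>x \<bullet> v\<bar> \<le> 2 * \<eta>" if "x \<in> K" for x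
  proof -
    have "x \<bullet> v = r x \<bullet> v"
      by (simp add: r_def inner_diff_left inner_sum_left vu)
    also have "\<bar>r x \<bullet> v\<bar> \<le> norm (r x)"
      using Cauchy_Schwarz_ineq2[of "r x" v] nv by simp
    finally show ?thesis
      using S_ub[OF that] \<eta> by linarith
  qed
  have p_eq: "p = (\<Sum>i\<in>A. (p \<bullet> u i) *\<^sub>R u i) + \<eta> *\<^sub>R v"
    using \<eta> by (simp add: v_def r_def)
  \<comment> \<open>The slab consists of the heights \<open>s\<close> between \<sigma> and 2\<sigma>
    in the cone with apex \<open>p\<close>. The new sides are \<sigma> times \<open>h i\<close>, one
    more factor 16 below the old ones.\<close>
  define \<sigma> where "\<sigma> = c / 16"
  have \<sigma>: "0 < \<sigma>" "\<sigma> \<le> 1 / 16"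
    using c by (auto simp: \<sigma>_def)
  have b_bd: "\<bar>b i\<bar> \<le> 2 * h i" if "i \<in> A" for i
  proof -
    have "(\<Sum>i\<in>A. b i *\<^sub>R u i) \<in> K"
      by (rule box) (use h in \<open>auto simp: less_imp_le\<close>)
    then show ?thesis
      using h(2)[OF that] orthonormal_inner_sum[OF u \<open>finite A\<close> that] by metis
  qed
  define u' where "u' = u(k := v)"
  define h' where "h' = h(k := \<eta>)"
  \<comment> \<open>At height \<open>s\<close> the lower corner of the section is
    \<open>b i + s * (p \<bullet> u i - b i)\<close>. Both \<open>p \<bullet> u i\<close> and
    \<open>b i\<close> are at most \<open>2 * h i\<close> in absolute value, so across the slab this
    corner drifts by at most \<open>4 * \<sigma> * h i\<close>. Starting that much higher keeps the
    new box above it at every height.\<close>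
  define b' where "b' = (\<lambda>i. b i + \<sigma> * (p \<bullet> u i - b i) + 4 * \<sigma> * h i)(k := \<sigma> * \<eta>)"
  have keq [simp]: "i \<in> A \<Longrightarrow> i \<noteq> k" for i
    using insert by auto
  have "orthonormal_family (insert k A) u'"
    using u v1 vu insert(2) by (auto simp: orthonormal_family_def u'_def)
  moreover have "\<forall>i\<in>insert k A. h' i > 0 \<and> (\<forall>x\<in>K. \<bar>x \<bullet> u' i\<bar> \<le> 2 * h' i)"
    using h \<eta> v_bd by (auto simp: h'_def u'_def)
  moreover have "(\<Sum>i\<in>insert k A. t i *\<^sub>R u' i) \<in> K"
    if t: "\<forall>i\<in>insert k A. b' i \<le> t i \<and> t i \<le> b' i + h' i / 16 ^ card (insert k A)" for t
  proof -
    have c16: "16 ^ card (insert k A) = 16 * (16::real) ^ card A"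
      using insert by simp
    have tA: "b i + \<sigma> * (p \<bullet> u i - b i) + 4 * \<sigma> * h i \<le> t i"
      "t i \<le> b i + \<sigma> * (p \<bullet> u i - b i) + 5 * \<sigma> * h i" if "i \<in> A" for i
      using t that unfolding c16 by (auto simp: b'_def h'_def \<sigma>_def c_def)
    define s where "s = t k / \<eta>"
    have "\<sigma> * \<eta> \<le> t k" "t k \<le> \<sigma> * \<eta> + \<sigma> * \<eta>"
      using t unfolding c16 by (auto simp: b'_def h'_def \<sigma>_def c_def)
    then have s: "\<sigma> \<le> s" "s \<le> 2 * \<sigma>"
      using \<eta> by (auto simp: s_def field_simps)
    have s1: "0 \<le> s" "s < 1"
      using s \<sigma> by linarith+
    \<comment> \<open>Coordinates of the base point whose segment to \<open>p\<close> passes through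
      the given point at parameter \<open>s\<close>.\<close>
    define t' where "t' i = (t i - s * (p \<bullet> u i)) / (1 - s)" for i
    have "(\<Sum>i\<in>A. t' i *\<^sub>R u i) \<in> K"
    proof (rule box)
      fix i assume i: "i \<in> A"
      define a where "a = p \<bullet> u i"
      have ab: "\<bar>a\<bar> \<le> 2 * h i" "\<bar>b i\<bar> \<le> 2 * h i" "h i > 0"
        using h(2)[OF i p(1)] b_bd[OF i] h(1)[OF i] by (auto simp: a_def)
      have "\<bar>(s - \<sigma>) * (a - b i)\<bar> \<le> \<sigma> * (4 * h i)"
        unfolding abs_mult using s ab by (intro mult_mono) auto
      then have d: "\<bar>s * a - s * b i - \<sigma> * a + \<sigma> * b i\<bar> \<le> 4 * \<sigma> * h i"
        by (simp add: algebra_simps)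
      have lo: "(1 - s) * b i \<le> t i - s * a"
        using tA(1)[OF i] d unfolding a_def[symmetric] by (simp add: algebra_simps)
      have "t i - s * a - (1 - s) * b i \<le> 9 * \<sigma> * h i"
        using tA(2)[OF i] d unfolding a_def[symmetric] by (simp add: algebra_simps)
      \<comment> \<open>Drift 4, offset 4 and side 1 add up to 9; the section still has at least 7/8
        of the side \<open>c * h i\<close>, and 9/16 is below 7/8.\<close>
      also have "9 * \<sigma> \<le> (1 - s) * c"
      proof -
        have "1 - s \<ge> 7/8"
          using s \<sigma> by linarith
        then have "(1 - s) * c \<ge> 7/8 * c"
          using c by (intro mult_right_mono) auto
        then show ?thesis
          using c by (simp add: \<sigma>_def)
      qed
      finally have hi: "t i - s * a \<le> (1 - s) * (b i + c * h i)"
        using ab by (simp add: algebra_simps)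
      show "b i \<le> t' i \<and> t' i \<le> b i + h i / 16 ^ card A"
        using lo hi s1 by (simp add: t'_def a_def[symmetric] c_def field_simps)
    qed
    then have "(1 - s) *\<^sub>R (\<Sum>i\<in>A. t' i *\<^sub>R u i) + s *\<^sub>R p \<in> K"
      using s1 by (intro convexD[OF K(1) _ p(1)]) auto
    also have "(1 - s) *\<^sub>R (\<Sum>i\<in>A. t' i *\<^sub>R u i) + s *\<^sub>R p
      = (\<Sum>i\<in>A. (t i - s * (p \<bullet> u i)) *\<^sub>R u i) + s *\<^sub>R ((\<Sum>i\<in>A. (p \<bullet> u i) *\<^sub>R u i) + \<eta> *\<^sub>R v)"
      using s1 p_eq by (simp add: scaleR_sum_right t'_def)
    also have "\<dots> = (\<Sum>i\<in>A. t i *\<^sub>R u i) + t k *\<^sub>R v"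
      using \<eta> by (simp add: scaleR_sum_right scaleR_right_distrib scaleR_left_diff_distrib
          sum_subtractf s_def)
    also have "\<dots> = (\<Sum>i\<in>insert k A. t i *\<^sub>R u' i)"
      using insert by (simp add: u'_def add.commute)
    finally show ?thesis .
  qed
  ultimately show ?case
    by blast
qed

text \<open>The volumes are compared by covering \<open>K\<close> with a homothetic copy of the rectangle, because the
  library has the orthogonal invariance of Lebesgue measure only for well-ordered index types.\<close>

lemma convex_contains_rectangle:
  fixes K :: "'a::euclidean_space set"
  assumes K: "convex K" "bounded K" "interior K \<noteq> {}"
  obtains R where "rectangle R" "R \<subseteq> K"
    "measure lebesgue K \<le> (4 * 16 ^ DIM('a)) ^ DIM('a) * measure lebesgue R"
proof -
  define q :: real where "q = 16 ^ DIM('a)"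
  have q: "q > 0"
    by (simp add: q_def)
  obtain p where p: "p \<in> K"
    using K interior_subset by blast
  \<comment> \<open>The greedy construction measures extents from the origin, so a point of
    \<open>K\<close> is moved there.\<close>
  define K0 where "K0 = (+) (- p) ` K"
  have K0: "convex K0" "bounded K0" "0 \<in> K0" "interior K0 \<noteq> {}"
    unfolding K0_def using K(1) bounded_translation[OF K(2), of "- p"] interior_translation[of "- p" K]
      K(3) p by (auto simp: convex_translation intro!: image_eqI[of _ _ p])
  from greedy_frame[OF K0 finite_Basis order_refl]
  obtain u :: "'a \<Rightarrow> 'a" and h b where u: "orthonormal_family Basis u"
    and h': "\<forall>i\<in>Basis. h i > 0 \<and> (\<forall>x\<in>K0. \<bar>x \<bullet> u i\<bar> \<le> 2 * h i)"
    and box': "\<forall>t. (\<forall>i\<in>Basis. b i \<le> t i \<and> t i \<le> b i + h i / q) \<longrightarrow>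
      (\<Sum>i\<in>Basis. t i *\<^sub>R u i) \<in> K0"
    unfolding q_def by (elim exE conjE)
  have h: "\<And>i. i \<in> Basis \<Longrightarrow> h i > 0" "\<And>i x. i \<in> Basis \<Longrightarrow> x \<in> K0 \<Longrightarrow> \<bar>x \<bullet> u i\<bar> \<le> 2 * h i"
    using h' by auto
  have box: "\<And>t. (\<And>i. i \<in> Basis \<Longrightarrow> b i \<le> t i \<and> t i \<le> b i + h i / q) \<Longrightarrow>
      (\<Sum>i\<in>Basis. t i *\<^sub>R u i) \<in> K0"
    using box' by blast
  \<comment> \<open>The linear map taking each basis vector \<open>i\<close> to \<open>u i\<close>;
    it turns the frame box into an orthogonal image of a \<open>cbox\<close>.\<close>
  define f where "f x = (\<Sum>i\<in>Basis. (x \<bullet> i) *\<^sub>R u i)" for x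
  have f_u: "f x \<bullet> u i = x \<bullet> i" if "i \<in> Basis" for x i
    unfolding f_def by (rule orthonormal_inner_sum[OF u _ that]) simp
  have lin: "linear f"
    unfolding f_def
    by (intro linearI) (simp_all add: inner_add_left scaleR_left_distrib sum.distrib scaleR_sum_right)
  have "f x \<bullet> f y = x \<bullet> y" for x y
  proof -
    have "f x \<bullet> f y = (\<Sum>i\<in>Basis. (y \<bullet> i) * (f x \<bullet> u i))"
      by (subst (2) f_def) (simp add: inner_sum_right)
    also have "\<dots> = (\<Sum>i\<in>Basis. (x \<bullet> i) * (y \<bullet> i))"
      by (simp add: f_u mult.commute)
    finally show ?thesis
      by (simp add: euclidean_inner[of x y])
  qed
  then have orth: "orthogonal_transformation f"
    using lin by (simp add: orthogonal_transformation_def)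
  define a1 where "a1 = (\<Sum>i\<in>Basis. b i *\<^sub>R i)"
  define b1 where "b1 = (\<Sum>i\<in>Basis. (b i + h i / q) *\<^sub>R i)"
  have coords: "a1 \<bullet> i = b i" "b1 \<bullet> i = b i + h i / q" if "i \<in> Basis" for i
    using that by (simp_all add: a1_def b1_def)
  define R where "R = f ` cbox a1 b1"
  have R: "rectangle R"
    unfolding rectangle_def R_def using orth h(1) q coords by (auto intro!: exI)
  have RK: "R \<subseteq> K0"
  proof
    fix x assume "x \<in> R"
    then obtain y where y: "x = f y" "y \<in> cbox a1 b1"
      by (auto simp: R_def)
    show "x \<in> K0"
      unfolding y(1) f_def
      by (rule box) (use y(2) coords in \<open>auto simp: mem_box\<close>)
  qed
  \<comment> \<open>The centre of the box. Its half-sides are \<open>h i / (2 * q)\<close> while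
    \<open>K0\<close> has coordinates at most \<open>2 * h i\<close>, so enlarging by
    \<open>4 * q\<close> and sending the centre to 0 covers \<open>K0\<close>.\<close>
  define m where "m = (1/2) *\<^sub>R (a1 + b1)"
  have "K0 \<subseteq> (\<lambda>x. (4 * q) *\<^sub>R x + (- (4 * q)) *\<^sub>R f m) ` R"
  proof
    fix x assume x: "x \<in> K0"
    obtain y where y: "x = f y"
      using orthogonal_transformation_surj[OF orth] by (metis surjD)
    have yi: "\<bar>y \<bullet> i\<bar> \<le> 2 * h i" if "i \<in> Basis" for i
      using h(2)[OF that x] f_u[OF that] y by simp
    define z where "z = m + (1 / (4 * q)) *\<^sub>R y"
    have "z \<in> cbox a1 b1"
      unfolding mem_box
    proof
      fix i :: 'a assume i: "i \<in> Basis"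
      have "\<bar>y \<bullet> i\<bar> / (4 * q) \<le> h i / (2 * q)"
        using yi[OF i] q by (simp add: field_simps)
      then have "\<bar>(y \<bullet> i) / (4 * q)\<bar> \<le> h i / (2 * q)"
        using q by (simp add: abs_divide)
      then show "a1 \<bullet> i \<le> z \<bullet> i \<and> z \<bullet> i \<le> b1 \<bullet> i"
        using coords[OF i] q
        by (auto simp: z_def m_def inner_add_left field_simps abs_le_iff)
    qed
    moreover have "x = (4 * q) *\<^sub>R f z + (- (4 * q)) *\<^sub>R f m"
      using q by (simp add: y z_def linear_add[OF lin] linear_scale[OF lin] scaleR_right_distrib)
    ultimately show "x \<in> (\<lambda>x. (4 * q) *\<^sub>R x + (- (4 * q)) *\<^sub>R f m) ` R"
      by (auto simp: R_def)
  qed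
  moreover have "compact ((\<lambda>x. (4 * q) *\<^sub>R x + (- (4 * q)) *\<^sub>R f m) ` R)"
    using q by (intro compact_rectangle rectangle_affine[OF R]) simp
  moreover have "K0 \<in> lmeasurable"
    using K0 by (simp add: measurable_convex)
  ultimately have "measure lebesgue K0
      \<le> measure lebesgue ((\<lambda>x. (4 * q) *\<^sub>R x + (- (4 * q)) *\<^sub>R f m) ` R)"
    by (simp add: measure_mono_fmeasurable lmeasurable_compact fmeasurableD)
  also have "\<dots> = (4 * q) ^ DIM('a) * measure lebesgue R"
    using q by (intro measure_homothety) simp
  finally have "measure lebesgue K0 \<le> (4 * q) ^ DIM('a) * measure lebesgue R" .
  moreover have "measure lebesgue K0 = measure lebesgue K"
    unfolding K0_def by (rule measure_translation)
  moreover have "measure lebesgue ((\<lambda>x. 1 *\<^sub>R x + p) ` R) = measure lebesgue R"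
    by (subst measure_homothety) auto
  moreover have "(\<lambda>x. 1 *\<^sub>R x + p) ` R \<subseteq> K"
    using RK by (auto simp: K0_def)
  ultimately show thesis
    using that[OF rectangle_affine[OF R, of 1 p]] by (simp add: q_def)
qed

text \<open>To obtain boundedness, \<open>K\<close> is cut by growing balls; by continuity from
  below some cut has volume above 1/2, which costs the extra factor 2.\<close>

lemma rectangle_in_convex_of_volume_1:
  fixes K :: "'a::euclidean_space set"
  assumes "convex K" "measure lebesgue K = 1"
  obtains R where "rectangle R" "R \<subseteq> K"
    "measure lebesgue R \<ge> 1 / (2 * (4 * 16 ^ DIM('a)) ^ DIM('a))"
proof -
  define C :: real where "C = (4 * 16 ^ DIM('a)) ^ DIM('a)"
  have C: "C > 0"
    by (simp add: C_def)
  \<comment> \<open>\<open>measure\<close> is 0 on non-measurable sets and on sets of infinite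
    measure, so the value 1 excludes both.\<close>
  have sets: "K \<in> sets lebesgue"
    using assms(2) measure_notin_sets by fastforce
  have K: "K \<in> lmeasurable"
    using assms(2) sets by (intro fmeasurableI) (auto simp: measure_def top.not_eq_extremum)
  define A where "A n = K \<inter> ball 0 (real n)" for n
  have A_sets: "A n \<in> lmeasurable" for n
    unfolding A_def using K by (intro fmeasurable_Int_fmeasurable) auto
  have un: "(\<Union>n. A n) = K"
    by (auto simp: A_def reals_Archimedean2)
  have "(\<lambda>n. measure lebesgue (A n)) \<longlonglongrightarrow> measure lebesgue (\<Union>n. A n)"
  proof (rule Lim_measure_incseq)
    show "range A \<subseteq> sets lebesgue"
      using A_sets by auto
    show "incseq A"
      by (auto simp: incseq_def A_def)
    show "emeasure lebesgue (\<Union>n. A n) \<noteq> \<infinity>"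
      using fmeasurableD2[OF K] by (simp add: un)
  qed
  then have "(\<lambda>n. measure lebesgue (A n)) \<longlonglongrightarrow> 1"
    using assms(2) by (simp add: un)
  then have "\<forall>\<^sub>F n in sequentially. 1 / 2 < measure lebesgue (A n)"
    by (rule order_tendstoD) simp
  then obtain n where n: "1 / 2 < measure lebesgue (A n)"
    by (auto simp: eventually_sequentially)
  have "convex (A n)" "bounded (A n)"
    using assms(1) by (auto simp: A_def convex_Int bounded_Int)
  moreover from this have "interior (A n) \<noteq> {}"
    using n negligible_convex_interior[of "A n"] negligible_imp_measure0 by fastforce
  ultimately obtain R where R: "rectangle R" "R \<subseteq> A n"
    "measure lebesgue (A n) \<le> C * measure lebesgue R"
    using convex_contains_rectangle unfolding C_def by metis
  then have "1 / (2 * C) \<le> measure lebesgue R"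
    using n C by (simp add: field_simps)
  with R that show thesis
    by (auto simp: A_def C_def)
qed

text \<open>With \<open>v\<close> the farthest point of \<open>R\<close> from 0 and contraction
  factor 1/4, norms stay at least 3/4 - 1/4 = 1/2 of \<open>norm v\<close>, which serves as
  \<open>\<rho>\<close>.\<close>

lemma rectangle_away_from_0:
  fixes R :: "'a::euclidean_space set"
  assumes R: "rectangle R"
  obtains R' \<rho> where "rectangle R'" "R' \<subseteq> R" "4 ^ DIM('a) * measure lebesgue R' = measure lebesgue R"
    "\<forall>x\<in>R'. \<rho> / 2 \<le> norm x \<and> norm x \<le> \<rho>"
proof -
  have "continuous_on R norm"
    by (intro continuous_intros)
  then obtain v where v: "v \<in> R" "\<And>x. x \<in> R \<Longrightarrow> norm x \<le> norm v"
    using continuous_attains_sup[OF compact_rectangle[OF R] rectangle_nonempty[OF R]] by blast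
  let ?R = "(\<lambda>x. (1/4) *\<^sub>R x + (3/4) *\<^sub>R v) ` R"
  show thesis
  proof
    show "rectangle ?R"
      by (rule rectangle_affine[OF R]) simp
    show sub: "?R \<subseteq> R"
      using convexD[OF convex_rectangle[OF R] _ v(1), of _ "1/4" "3/4"] by auto
    have "(4::real) ^ DIM('a) * (1/4) ^ DIM('a) = 1"
      by (simp flip: power_mult_distrib)
    then show "4 ^ DIM('a) * measure lebesgue ?R = measure lebesgue R"
      by (simp add: measure_homothety flip: mult.assoc)
    show "\<forall>x\<in>?R. norm v / 2 \<le> norm x \<and> norm x \<le> norm v"
    proof
      fix x assume x: "x \<in> ?R"
      then obtain y where y: "y \<in> R" "x = (1/4) *\<^sub>R y + (3/4) *\<^sub>R v"
        by blast
      have "norm ((3/4) *\<^sub>R v) - norm ((1/4) *\<^sub>R y) \<le> norm x"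
        unfolding y(2) by (metis add.commute norm_diff_ineq)
      then show "norm v / 2 \<le> norm x \<and> norm x \<le> norm v"
        using v(2)[OF y(1)] v(2)[of x] sub x by auto
    qed
  qed
qed

section \<open>Nets in the unit cube and their minimal size\<close>

definition box_net :: "real \<Rightarrow> 'a::euclidean_space set \<Rightarrow> bool" where
  "box_net \<epsilon> N \<longleftrightarrow> N \<subseteq> cbox 0 One \<and>
    (\<forall>R. rectangle R \<and> R \<subseteq> cbox 0 One \<and> measure lebesgue R = \<epsilon> \<longrightarrow> N \<inter> R \<noteq> {})"

lemma box_net_mono:
  assumes "box_net \<epsilon> N" "0 < \<epsilon>" "\<epsilon> \<le> \<epsilon>'"
  shows "box_net \<epsilon>' N"
  unfolding box_net_def
proof (intro conjI allI impI)
  show "N \<subseteq> cbox 0 One"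
    using assms by (simp add: box_net_def)
  fix R :: "'a set" assume R: "rectangle R \<and> R \<subseteq> cbox 0 One \<and> measure lebesgue R = \<epsilon>'"
  then obtain R' where "rectangle R'" "R' \<subseteq> R" "measure lebesgue R' = \<epsilon>"
    using subrectangle_of_measure[of R \<epsilon>] assms by auto
  then show "N \<inter> R \<noteq> {}"
    using assms(1) R unfolding box_net_def by blast
qed

text \<open>Shrinking a rectangle into the subcube divides its volume by \<open>3 ^ DIM('a)\<close>,
  so \<open>N\<close> meets the image, and the common point pulls back.\<close>

lemma box_net_subcube:
  fixes N :: "'a::euclidean_space set"
  assumes N: "box_net (\<epsilon> / 3 ^ DIM('a)) N"
    and c: "(\<lambda>x. (1/3) *\<^sub>R x + c) ` cbox 0 One \<subseteq> cbox 0 One"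
  shows "box_net \<epsilon> {x \<in> cbox 0 One. (1/3) *\<^sub>R x + c \<in> N}"
  unfolding box_net_def
proof (intro conjI allI impI)
  fix R :: "'a set" assume R: "rectangle R \<and> R \<subseteq> cbox 0 One \<and> measure lebesgue R = \<epsilon>"
  let ?R = "(\<lambda>x. (1/3) *\<^sub>R x + c) ` R"
  have "rectangle ?R"
    using R by (intro rectangle_affine) auto
  moreover have "?R \<subseteq> cbox 0 One"
    using R c by blast
  moreover have "measure lebesgue ?R = \<epsilon> / 3 ^ DIM('a)"
    using R by (simp add: measure_homothety power_divide)
  ultimately have "N \<inter> ?R \<noteq> {}"
    using N unfolding box_net_def by blast
  then show "{x \<in> cbox 0 One. (1/3) *\<^sub>R x + c \<in> N} \<inter> R \<noteq> {}"
    using R by blast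
qed auto

text \<open>The type argument fixes the space, which \<epsilon> does not determine. Without a finite
  net the \<open>LEAST\<close> is unspecified, hence the existence assumption when a minimal net is
  chosen.\<close>

definition net_number :: "'a::euclidean_space itself \<Rightarrow> real \<Rightarrow> nat" where
  "net_number _ \<epsilon> = (LEAST n. \<exists>N::'a set. finite N \<and> box_net \<epsilon> N \<and> card N = n)"

lemma net_number_le:
  fixes N :: "'a::euclidean_space set"
  assumes "finite N" "box_net \<epsilon> N"
  shows "net_number TYPE('a) \<epsilon> \<le> card N"
  unfolding net_number_def using assms by (intro Least_le) blast

lemma net_number_attained:
  assumes "\<exists>N::'a::euclidean_space set. finite N \<and> box_net \<epsilon> N"
  obtains N :: "'a::euclidean_space set" where "finite N" "box_net \<epsilon> N" "card N = net_number TYPE('a) \<epsilon>"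
proof -
  have "\<exists>n. \<exists>N::'a set. finite N \<and> box_net \<epsilon> N \<and> card N = n"
    using assms by blast
  from LeastI_ex[OF this] show thesis
    using that unfolding net_number_def by blast
qed

text \<open>Two disjoint subcubes of side \<open>1/3\<close> in opposite corners each need their own net.\<close>

lemma net_number_double:
  assumes "\<exists>N::'a::euclidean_space set. finite N \<and> box_net (\<epsilon> / 3 ^ DIM('a)) N"
  shows "2 * net_number TYPE('a::euclidean_space) \<epsilon> \<le> net_number TYPE('a) (\<epsilon> / 3 ^ DIM('a))"
proof -
  obtain N :: "'a set" where N: "finite N" "box_net (\<epsilon> / 3 ^ DIM('a)) N"
    "card N = net_number TYPE('a) (\<epsilon> / 3 ^ DIM('a))"
    using net_number_attained[OF assms] .
  define M where "M c = {x \<in> cbox 0 One. (1/3) *\<^sub>R x + c \<in> N}" for c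
  define \<phi> where "\<phi> c x = (1/3) *\<^sub>R x + c" for c x :: 'a
  have inj: "inj_on (\<phi> c) S" for c S
    by (auto simp: inj_on_def \<phi>_def)
  have img: "\<phi> c ` M c \<subseteq> N" for c
    by (auto simp: M_def \<phi>_def)
  have fin: "finite (M c)" for c
    using finite_imageD[OF finite_subset[OF img N(1)] inj] .
  have "net_number TYPE('a) \<epsilon> \<le> card (M 0)" "net_number TYPE('a) \<epsilon> \<le> card (M ((2/3) *\<^sub>R One))"
    unfolding M_def
    by (intro net_number_le fin[unfolded M_def] box_net_subcube[OF N(2)];
        force simp: mem_box inner_add_left)+
  then have "2 * net_number TYPE('a) \<epsilon> \<le> card (\<phi> 0 ` M 0) + card (\<phi> ((2/3) *\<^sub>R One) ` M ((2/3) *\<^sub>R One))"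
    by (simp add: card_image[OF inj])
  also have "\<dots> = card (\<phi> 0 ` M 0 \<union> \<phi> ((2/3) *\<^sub>R One) ` M ((2/3) *\<^sub>R One))"
  proof (rule card_Un_disjoint[symmetric])
    \<comment> \<open>A single coordinate separates the two subcubes: at most 1/3 on one, at least
      2/3 on the other.\<close>
    obtain i :: 'a where i: "i \<in> Basis"
      using nonempty_Basis by blast
    have "x \<bullet> i \<le> 1 / 3" if "x \<in> \<phi> 0 ` M 0" for x
      using that i by (auto simp: M_def \<phi>_def mem_box)
    moreover have "x \<bullet> i \<ge> 2 / 3" if "x \<in> \<phi> ((2/3) *\<^sub>R One) ` M ((2/3) *\<^sub>R One)" for x
      using that i by (auto simp: M_def \<phi>_def mem_box inner_add_left)
    ultimately show "\<phi> 0 ` M 0 \<inter> \<phi> ((2/3) *\<^sub>R One) ` M ((2/3) *\<^sub>R One) = {}"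
      by fastforce
  qed (use fin in auto)
  also have "\<dots> \<le> card N"
    using img N(1) by (intro card_mono) auto
  finally show ?thesis
    using N(3) by simp
qed

lemma sum_le_twice_last:
  fixes a :: "nat \<Rightarrow> nat"
  assumes "\<And>k. 2 * a k \<le> a (Suc k)"
  shows "(\<Sum>j\<le>k. a j) \<le> 2 * a k"
proof (induction k)
  case (Suc k)
  then show ?case
    using assms[of k] by simp
qed simp

section \<open>Nets from a Danzer set\<close>

text \<open>Dilating by \<open>\<epsilon> powr (- 1 / real DIM('a))\<close> turns volume \<epsilon>
  into volume 1, and the dilated cube fits in a ball of proportional radius; polynomial growth
  absorbs the factor.\<close>

lemma nets_from_danzer_set:
  fixes Y :: "'a::euclidean_space set"
  assumes Y: "danzer_set Y" "has_growth Y g" and g: "polynomial_growth g"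
  shows "\<exists>N :: real \<Rightarrow> 'a set. (\<forall>\<epsilon>>0. box_net \<epsilon> (N \<epsilon>)) \<and>
    card_bigo (at_right 0) N (\<lambda>\<epsilon>. g (\<epsilon> powr (- 1 / real DIM('a))))"
proof -
  define s where "s \<epsilon> = \<epsilon> powr (- 1 / real DIM('a))" for \<epsilon>
  define N where "N \<epsilon> = {x \<in> cbox 0 One. s \<epsilon> *\<^sub>R x \<in> Y}" for \<epsilon>
  \<comment> \<open>Points of the unit cube have norm at most \<open>DIM('a)\<close>; the added 1
    gives the strict inequality for an open ball.\<close>
  define C where "C = real DIM('a) + 1"
  have C: "C > 0"
    by (simp add: C_def add_pos_pos)
  have net: "box_net \<epsilon> (N \<epsilon>)" if "\<epsilon> > 0" for \<epsilon>
    unfolding box_net_def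
  proof (intro conjI allI impI)
    show "N \<epsilon> \<subseteq> cbox 0 One"
      by (auto simp: N_def)
    fix R :: "'a set" assume R: "rectangle R \<and> R \<subseteq> cbox 0 One \<and> measure lebesgue R = \<epsilon>"
    have s: "s \<epsilon> > 0"
      using that by (simp add: s_def)
    have sp: "s \<epsilon> ^ DIM('a) = 1 / \<epsilon>"
    proof -
      have "s \<epsilon> ^ DIM('a) = \<epsilon> powr (- 1 / real DIM('a) * real DIM('a))"
        unfolding s_def by (subst powr_power) (use that in auto)
      then show ?thesis
        using that by (simp add: powr_minus_divide)
    qed
    let ?R = "(\<lambda>x. s \<epsilon> *\<^sub>R x + 0) ` R"
    have "convex ?R"
      using R s by (intro convex_rectangle rectangle_affine) auto
    moreover have "measure lebesgue ?R = 1"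
      using R that by (subst measure_homothety[OF s]) (simp add: sp)
    ultimately have "Y \<inter> ?R \<noteq> {}"
      using Y(1) unfolding danzer_set_def by blast
    then show "N \<epsilon> \<inter> R \<noteq> {}"
      using R by (auto simp: N_def)
  qed
  have s_lim: "filterlim (\<lambda>\<epsilon>. C * s \<epsilon>) at_top (at_right 0)" "filterlim s at_top (at_right 0)"
  proof -
    show "filterlim s at_top (at_right 0)"
      unfolding s_def using DIM_positive[where 'a='a] by real_asymp
    then show "filterlim (\<lambda>\<epsilon>. C * s \<epsilon>) at_top (at_right 0)"
      using C by (intro filterlim_tendsto_pos_mult_at_top[OF tendsto_const])
  qed
  have growth: "\<forall>\<^sub>F T in at_top. finite (Y \<inter> ball 0 T)"
    "(\<lambda>T. real (card (Y \<inter> ball 0 T))) \<in> O[at_top](g)"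
    using Y(2) by (auto simp: has_growth_def card_bigo_def)
  have pos: "\<forall>\<^sub>F \<epsilon> in at_right 0. (\<epsilon>::real) > 0"
    by (rule eventually_at_right_less)
  have fin: "\<forall>\<^sub>F \<epsilon> in at_right 0. finite (Y \<inter> ball 0 (C * s \<epsilon>))"
    using s_lim(1) growth(1) by (rule eventually_compose_filterlim[rotated])
  have bd: "finite (N \<epsilon>) \<and> card (N \<epsilon>) \<le> card (Y \<inter> ball 0 (C * s \<epsilon>))"
    if "\<epsilon> > 0" "finite (Y \<inter> ball 0 (C * s \<epsilon>))" for \<epsilon>
  proof -
    have s: "s \<epsilon> > 0"
      using that by (simp add: s_def)
    have inj: "inj_on ((*\<^sub>R) (s \<epsilon>)) (N \<epsilon>)"
      using s by (auto simp: inj_on_def)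
    have sub: "(*\<^sub>R) (s \<epsilon>) ` N \<epsilon> \<subseteq> Y \<inter> ball 0 (C * s \<epsilon>)"
    proof -
      have "norm x < C" if "x \<in> cbox 0 One" for x :: 'a
      proof -
        have "norm x \<le> (\<Sum>i\<in>Basis. \<bar>x \<bullet> i\<bar>)"
          by (rule norm_le_l1)
        also have "\<dots> \<le> (\<Sum>i\<in>(Basis::'a set). 1)"
          using that by (intro sum_mono) (auto simp: mem_box)
        finally show ?thesis
          by (simp add: C_def)
      qed
      then show ?thesis
        using s by (auto simp: N_def mult.commute)
    qed
    show ?thesis
      using finite_imageD[OF finite_subset[OF sub that(2)] inj] card_mono[OF that(2) sub]
      by (simp add: card_image[OF inj])
  qed
  have "(\<lambda>\<epsilon>. real (card (N \<epsilon>))) \<in> O[at_right 0](\<lambda>\<epsilon>. real (card (Y \<inter> ball 0 (C * s \<epsilon>))))"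
    by (rule bigoI[of _ 1]) (use pos fin in eventually_elim, use bd in simp)
  also have "(\<lambda>\<epsilon>. real (card (Y \<inter> ball 0 (C * s \<epsilon>)))) \<in> O[at_right 0](\<lambda>\<epsilon>. g (C * s \<epsilon>))"
    by (rule landau_o.big.compose[OF growth(2) s_lim(1)])
  also have "(\<lambda>\<epsilon>. g (C * s \<epsilon>)) \<in> O[at_right 0](\<lambda>\<epsilon>. g (s \<epsilon>))"
    using g C unfolding polynomial_growth_def
    by (intro landau_o.big.compose[OF _ s_lim(2)]) blast
  finally have bigo: "(\<lambda>\<epsilon>. real (card (N \<epsilon>))) \<in> O[at_right 0](\<lambda>\<epsilon>. g (s \<epsilon>))" .
  have "\<forall>\<^sub>F \<epsilon> in at_right 0. finite (N \<epsilon>)"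
    using pos fin by eventually_elim (use bd in simp)
  with bigo have "card_bigo (at_right 0) N (\<lambda>\<epsilon>. g (s \<epsilon>))"
    by (simp add: card_bigo_def)
  with net show ?thesis
    unfolding s_def by blast
qed

section \<open>A Danzer set from nets\<close>

lemma danzer_set_from_nets:
  fixes N :: "real \<Rightarrow> 'a::euclidean_space set"
  assumes net: "\<And>\<epsilon>. \<epsilon> > 0 \<Longrightarrow> box_net \<epsilon> (N \<epsilon>)"
    and card_N: "card_bigo (at_right 0) N (\<lambda>\<epsilon>. g (\<epsilon> powr (- 1 / real DIM('a))))"
    and g: "polynomial_growth g"
  shows "\<exists>Y :: 'a set. danzer_set Y \<and> has_growth Y g"
proof -
  define \<kappa> :: real where "\<kappa> = 1 / (2 * (4 * 16 ^ DIM('a)) ^ DIM('a))"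
  have \<kappa>: "\<kappa> > 0"
    by (simp add: \<kappa>_def)
  \<comment> \<open>The 8 is 4 from the contraction into the annulus times 2 from the side
    \<open>2 * 3 ^ k\<close> of the scaled cube.\<close>
  define \<epsilon> :: "nat \<Rightarrow> real" where "\<epsilon> k = \<kappa> / (8 * 3 ^ k) ^ DIM('a)" for k
  have \<epsilon>: "\<epsilon> k > 0" "\<epsilon> (Suc k) = \<epsilon> k / 3 ^ DIM('a)" for k
  proof -
    show "\<epsilon> k > 0"
      using \<kappa> by (simp add: \<epsilon>_def)
    have "(8 * 3 ^ Suc k) ^ DIM('a) = (8 * 3 ^ k) ^ DIM('a) * (3::real) ^ DIM('a)"
      unfolding power_mult_distrib[symmetric] by simp
    then show "\<epsilon> (Suc k) = \<epsilon> k / 3 ^ DIM('a)"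
      by (simp only: \<epsilon>_def divide_divide_eq_left)
  qed
  have ev_fin: "\<forall>\<^sub>F \<delta> in at_right 0. finite (N \<delta>)"
    using card_N by (simp add: card_bigo_def)
  \<comment> \<open>The nets \<open>N\<close> are known to be finite only near 0; a finite net for a
    smaller volume also serves \<delta>.\<close>
  have ex: "\<exists>M::'a set. finite M \<and> box_net \<delta> M" if "\<delta> > 0" for \<delta>
  proof -
    have "\<forall>\<^sub>F x in at_right 0. x \<in> {0<..<\<delta>}"
      using that by (rule eventually_at_right_real)
    with ev_fin have "\<forall>\<^sub>F x in at_right 0. finite (N x) \<and> 0 < x \<and> x < \<delta>"
      by eventually_elim auto
    then obtain x where "finite (N x)" "0 < x" "x < \<delta>"
      using eventually_happens[of _ "at_right (0::real)"] by force
    then show ?thesis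
      using box_net_mono[OF net] by (meson less_imp_le)
  qed
  define n where "n = net_number TYPE('a)"
  have "\<exists>M::'a set. finite M \<and> box_net (\<epsilon> k) M \<and> card M = n (\<epsilon> k)" for k
    using net_number_attained[OF ex[OF \<epsilon>(1)]] unfolding n_def by metis
  then obtain M :: "nat \<Rightarrow> 'a set" where M: "\<And>k. finite (M k)" "\<And>k. box_net (\<epsilon> k) (M k)"
    "\<And>k. card (M k) = n (\<epsilon> k)"
    by metis
  have double: "2 * n (\<epsilon> k) \<le> n (\<epsilon> (Suc k))" for k
    unfolding n_def \<epsilon>(2) by (rule net_number_double) (rule ex, use \<epsilon>(1)[of k] in simp)
  \<comment> \<open>Maps the cube of half-side \<open>3 ^ k\<close> about 0 onto the unit
    cube.\<close>
  define \<psi> :: "nat \<Rightarrow> 'a \<Rightarrow> 'a" where "\<psi> k y = (1 / (2 * 3 ^ k)) *\<^sub>R y + (1/2) *\<^sub>R One" for k y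
  define Y where "Y = (\<Union>k. {y. \<psi> k y \<in> M k \<and> (k = 0 \<or> 3 ^ k / 6 \<le> norm y)})"
  have "Y \<inter> K \<noteq> {}" if K: "convex K" "measure lebesgue K = 1" for K
  proof -
    obtain R0 where R0: "rectangle R0" "R0 \<subseteq> K" "measure lebesgue R0 \<ge> \<kappa>"
      using rectangle_in_convex_of_volume_1[OF K] unfolding \<kappa>_def .
    obtain R \<rho> where R: "rectangle R" "R \<subseteq> R0" "4 ^ DIM('a) * measure lebesgue R = measure lebesgue R0"
      and \<rho>: "\<forall>x\<in>R. \<rho> / 2 \<le> norm x \<and> norm x \<le> \<rho>"
      by (rule rectangle_away_from_0[OF R0(1)])
    \<comment> \<open>Minimality gives \<open>3 ^ k / 3 < \<rho>\<close> unless
      \<open>k = 0\<close>, so points of \<open>R\<close>, of norm at least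
      \<open>\<rho> / 2\<close>, pass the cutoff \<open>3 ^ k / 6\<close> in
      \<open>Y\<close>.\<close>
    define k where "k = (LEAST k. \<rho> \<le> 3 ^ k)"
    obtain k0 :: nat where "\<rho> < 3 ^ k0"
      using real_arch_pow[of 3 \<rho>] by auto
    have k: "\<rho> \<le> 3 ^ k"
      unfolding k_def by (rule LeastI[of _ k0], use \<open>\<rho> < 3 ^ k0\<close> in simp)
    have k_least: "k = 0 \<or> 3 ^ k / 3 < \<rho>"
    proof (cases k)
      case (Suc j)
      then have "\<not> \<rho> \<le> 3 ^ j"
        unfolding k_def by (metis lessI not_less_Least)
      then show ?thesis
        using Suc by simp
    qed simp
    have "measure lebesgue (\<psi> k ` R) = (1 / (2 * 3 ^ k)) ^ DIM('a) * measure lebesgue R"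
      unfolding \<psi>_def by (rule measure_homothety) simp
    also have "\<dots> = measure lebesgue R0 / (8 * 3 ^ k) ^ DIM('a)"
    proof -
      have "(8 * 3 ^ k) ^ DIM('a) = (4::real) ^ DIM('a) * (2 * 3 ^ k) ^ DIM('a)"
        unfolding power_mult_distrib[symmetric] by simp
      then show ?thesis
        unfolding R(3)[symmetric] by (simp add: power_one_over)
    qed
    also have "\<dots> \<ge> \<epsilon> k"
      unfolding \<epsilon>_def using R0(3) by (intro divide_right_mono) auto
    finally have meas: "\<epsilon> k \<le> measure lebesgue (\<psi> k ` R)" .
    have rect: "rectangle (\<psi> k ` R)"
      unfolding \<psi>_def by (rule rectangle_affine[OF R(1)]) simp
    obtain R' where R': "rectangle R'" "R' \<subseteq> \<psi> k ` R" "measure lebesgue R' = \<epsilon> k"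
      by (rule subrectangle_of_measure[OF rect \<epsilon>(1) meas])
    have "\<psi> k ` R \<subseteq> cbox 0 One"
    proof clarify
      fix y assume "y \<in> R"
      then have "norm y \<le> 3 ^ k"
        using \<rho> k by fastforce
      then have "0 \<le> y \<bullet> i + 3 ^ k \<and> y \<bullet> i \<le> 3 ^ k" if "i \<in> Basis" for i
        using Basis_le_norm[OF that, of y] by linarith
      then show "\<psi> k y \<in> cbox 0 One"
        by (auto simp: \<psi>_def mem_box inner_add_left field_simps)
    qed
    then have "M k \<inter> R' \<noteq> {}"
      using M(2)[of k] R' unfolding box_net_def by blast
    then obtain y where y: "y \<in> R" "\<psi> k y \<in> M k"
      using R'(2) by blast
    have "k = 0 \<or> 3 ^ k / 6 \<le> norm y"
      using bspec[OF \<rho> y(1)] k_least by auto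
    then have "y \<in> Y"
      using y by (auto simp: Y_def)
    then show ?thesis
      using y(1) R(2) R0(2) by blast
  qed
  then have "danzer_set Y"
    by (auto simp: danzer_set_def)
  moreover have "has_growth Y g"
  proof -
    define c where "c = 48 / \<kappa> powr (1 / DIM('a))"
    have c: "c > 0"
      using \<kappa> by (simp add: c_def)
    \<comment> \<open>A volume below \<epsilon> at the last relevant scale: there
      \<open>3 ^ k \<le> 6 * T\<close>, and 48 = 8 * 6. The constant \<open>c\<close> is chosen so
      that the argument of \<open>g\<close> becomes \<open>c * T\<close>.\<close>
    define \<delta> where "\<delta> T = \<kappa> / (48 * T) ^ DIM('a)" for T
    have \<delta>_powr: "\<delta> T powr (- 1 / real DIM('a)) = c * T" if "T > 0" for T
    proof -
      have "\<delta> T = (c * T) powr (- real DIM('a))"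
        using that \<kappa> c
        by (simp add: \<delta>_def c_def powr_minus_divide powr_realpow power_mult_distrib power_divide
            powr_power)
      then show ?thesis
        using that c by (simp add: powr_powr)
    qed
    have \<delta>_lim: "filterlim \<delta> (at_right 0) at_top"
      unfolding \<delta>_def using \<kappa> DIM_positive[where 'a='a] by real_asymp
    have bd: "finite (Y \<inter> ball 0 T) \<and> card (Y \<inter> ball 0 T) \<le> 2 * card (N (\<delta> T))"
      if T: "T \<ge> 1" and fin: "finite (N (\<delta> T))" for T
    proof -
      \<comment> \<open>The last scale that can reach the ball: for \<open>j > k\<close> the cutoff
        \<open>3 ^ j / 6\<close> is at least \<open>T\<close>. Minimality, or
        \<open>T \<ge> 1\<close> when \<open>k = 0\<close>, gives
        \<open>3 ^ k \<le> 6 * T\<close>.\<close>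
      define k where "k = (LEAST k. 6 * T \<le> 3 ^ Suc k)"
      obtain k0 :: nat where k0: "6 * T < 3 ^ k0"
        using real_arch_pow[of 3 "6 * T"] by auto
      have k: "6 * T \<le> 3 ^ Suc k"
        unfolding k_def by (rule LeastI[of _ k0]) (use k0 T in simp)
      have "3 ^ k \<le> 6 * T"
      proof (cases k)
        case (Suc j)
        then have "\<not> 6 * T \<le> 3 ^ Suc j"
          unfolding k_def by (metis lessI not_less_Least)
        then show ?thesis
          using Suc by simp
      qed (use T in simp)
      then have le: "\<delta> T \<le> \<epsilon> k"
        unfolding \<delta>_def \<epsilon>_def using \<kappa> T by (intro divide_left_mono power_mono) auto
      have inj: "inj (\<psi> j)" for j
        by (auto simp: inj_on_def \<psi>_def)
      have fin_j: "finite (\<psi> j -` M j)" for j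
        using M(1) inj by (rule finite_vimageI)
      have sub: "Y \<inter> ball 0 T \<subseteq> (\<Union>j\<le>k. \<psi> j -` M j)"
      proof
        fix y assume "y \<in> Y \<inter> ball 0 T"
        then obtain j where j: "\<psi> j y \<in> M j" "j = 0 \<or> 3 ^ j / 6 \<le> norm y" "norm y < T"
          by (auto simp: Y_def)
        have "j \<le> k"
        proof (cases "j = 0")
          case False
          then have "(3::real) ^ j < 3 ^ Suc k"
            using j k by linarith
          then show ?thesis
            by (simp del: power_Suc)
        qed simp
        with j show "y \<in> (\<Union>j\<le>k. \<psi> j -` M j)"
          by auto
      qed
      have "card (Y \<inter> ball 0 T) \<le> card (\<Union>j\<le>k. \<psi> j -` M j)"
        using fin_j by (intro card_mono sub) auto
      also have "\<dots> \<le> (\<Sum>j\<le>k. card (\<psi> j -` M j))"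
        by (rule card_UN_le) simp
      also have "\<dots> \<le> (\<Sum>j\<le>k. n (\<epsilon> j))"
        using M(1,3) inj by (intro sum_mono) (metis card_vimage_inj_on_le Int_UNIV_right)
      also have "\<dots> \<le> 2 * n (\<epsilon> k)"
        using double by (rule sum_le_twice_last)
      \<comment> \<open>As a net for the smaller volume \<open>\<delta> T\<close>,
        \<open>N (\<delta> T)\<close> is also one for \<open>\<epsilon> k\<close>, so it has at
        least the minimal size.\<close>
      also have "n (\<epsilon> k) \<le> card (N (\<delta> T))"
        unfolding n_def using \<kappa> T le
        by (intro net_number_le fin box_net_mono[OF net _ le]) (auto simp: \<delta>_def)
      finally show ?thesis
        using finite_subset[OF sub] fin_j by auto
    qed
    have fin: "\<forall>\<^sub>F T in at_top. finite (N (\<delta> T))"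
      using \<delta>_lim ev_fin by (rule eventually_compose_filterlim[rotated])
    have ge1: "\<forall>\<^sub>F T in at_top. (T::real) \<ge> 1"
      by (rule eventually_ge_at_top)
    have "(\<lambda>T. real (card (Y \<inter> ball 0 T))) \<in> O(\<lambda>T. real (card (N (\<delta> T))))"
      by (rule bigoI[of _ 2]) (use ge1 fin in eventually_elim, use bd in force)
    also have "(\<lambda>T. real (card (N (\<delta> T)))) \<in> O(\<lambda>T. g (\<delta> T powr (- 1 / real DIM('a))))"
      using card_N unfolding card_bigo_def by (intro landau_o.big.compose[OF _ \<delta>_lim]) blast
    also have "(\<lambda>T. g (\<delta> T powr (- 1 / real DIM('a)))) \<in> \<Theta>(\<lambda>T. g (c * T))"
      by (intro bigthetaI_cong) (use ge1 in eventually_elim, use \<delta>_powr in simp)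
    also have "(\<lambda>T. g (c * T)) \<in> O(g)"
      using g c by (simp add: polynomial_growth_def)
    finally have bigo: "(\<lambda>T. real (card (Y \<inter> ball 0 T))) \<in> O(g)" .
    have "\<forall>\<^sub>F T in at_top. finite (Y \<inter> ball 0 T)"
      using ge1 fin by eventually_elim (use bd in simp)
    with bigo show ?thesis
      by (simp add: has_growth_def card_bigo_def)
  qed
  ultimately show ?thesis
    by blast
qed

theorem theorem1p4:
  fixes g :: "real \<Rightarrow> real"
  assumes dim: "CARD('n::finite) \<ge> 2"
    and g_pos: "\<And>x. x > 0 \<Longrightarrow> g x > 0"
    and g_growth: "polynomial_growth g"
  shows "(\<exists>Y :: (real ^ 'n) set. danzer_set Y \<and> has_growth Y g) \<longleftrightarrow>
    (\<exists>N :: real \<Rightarrow> (real ^ 'n) set.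
       (\<forall>\<epsilon>>0. N \<epsilon> \<subseteq> cbox 0 1 \<and>
          (\<forall>R. rectangle R \<and> R \<subseteq> cbox 0 1 \<and> measure lebesgue R = \<epsilon> \<longrightarrow> N \<epsilon> \<inter> R \<noteq> {})) \<and>
       card_bigo (at_right 0) N (\<lambda>\<epsilon>. g (\<epsilon> powr (- 1 / real CARD('n)))))"
proof -
  \<comment> \<open>The all-ones vector of \<open>real ^ 'n\<close> is the sum of the basis vectors,
    which identifies the cube of the statement with that of \<open>box_net\<close>.\<close>
  have one: "(1 :: real ^ 'n) = One"
  proof (rule euclidean_eqI)
    fix b :: "real ^ 'n" assume b: "b \<in> Basis"
    then have "1 \<bullet> b = 1"
      by (auto simp: Basis_vec_def inner_axis)
    with b show "1 \<bullet> b = One \<bullet> b"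
      by simp
  qed
  show ?thesis
    unfolding one box_net_def[symmetric]
    using nets_from_danzer_set[OF _ _ g_growth, where 'a = "real ^ 'n"]
      danzer_set_from_nets[OF _ _ g_growth, where 'a = "real ^ 'n"]
    by auto
qed

end
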